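(* Let $\|\cdot\|$ be a smooth and strictly convex norm on $\mathbb{R}^n$, and let $f:\mathbb{R}^n\to\mathbb{R}$ be a convex function differentiable at a point $x\in\mathbb{R}^n$. Then $$f(y)-f(x)\ge\mathcal{L}(\nabla f(x))\cdot(y-x)$$ for every $y\in\mathbb{R}^n$. Conversely, the norm gradient $\nabla f(x)$ is the unique vector for which this inequality holds for every $y\in\mathbb{R}^n$; that is, if $v\in\mathbb{R}^n$ satisfies $f(y)-f(x)\ge\mathcal{L}(v)\cdot(y-x)$ for every $y\in\mathbb{R}^n$, then $v=\nabla f(x)$.
   Context: A norm is smooth if its unit ball $B=\{x:\|x\|\le 1\}$ has a unique supporting hyperplane at each boundary point, and strictly convex if $\partial B$ contains no (non-degenerate) line segment. A hyperplane supports a closed convex set $C$ at $x\in\partial C$ if $C$ is contained in one of the closed half-spaces determined by the translate of the hyperplane through $x$. Birkhoff orthogonality: $x\dashv_B y$ means $\|x+ty\|\ge\|x\|$ for all $t\in\mathbb{R}$; for a hyperplane $\mathbf{h}$ (taken through the origin), $x\dashv_B\mathbf{h}$ means $x\dashv_B z$ for all $z\in\mathbf{h}$; then $x$ is Birkhoff left-orthogonal to $\mathbf{h}$ and $\mathbf{h}$ is Birkhoff right-orthogonal to $x$. Legendre transform: $\mathcal{L}:\mathbb{R}^n\to(\mathbb{R}^n)^*$ sends $x\ne 0$ to the unique linear functional $\mathcal{L}(x)$ whose kernel is the (unique) hyperplane Birkhoff right-orthogonal to $x$ and with $\mathcal{L}(x)\cdot x=\|x\|^2$; $\mathcal{L}(0)=0$.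 Norm gradient: let $f:\mathbb{R}^n\to\mathbb{R}$ be convex and (Fréchet) differentiable at $x$, and put $c=f(x)$. If $c$ is not the global minimum of $f$, then $\nabla f(x)$ is the unique non-zero vector such that (a) $\nabla f(x)$ is Birkhoff left-orthogonal to the (unique) supporting hyperplane of the sub-level set $\{f\le c\}$ at $x$, and (b) $df_x(\nabla f(x))=\|\nabla f(x)\|^2$. If $c$ is the global minimum, $\nabla f(x)=0$. *)

theory Defs
  imports "HOL-Analysis.Analysis"
begin

text \<open>
  The norm under study is an arbitrary function \<open>N\<close> satisfying the norm axioms. The type class
  norm of \<open>real ^ 'n\<close> is Euclidean; it only supplies the topology and differentiability, which in
  finite dimension do not depend on the choice of norm. The inner product is used only to
  parametrise linear hyperplanes and half-spaces.
\<close>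

definition is_norm :: "('a::real_vector \<Rightarrow> real) \<Rightarrow> bool" where
  "is_norm N \<longleftrightarrow>
     (\<forall>x. 0 \<le> N x) \<and> (\<forall>x. N x = 0 \<longleftrightarrow> x = 0) \<and>
     (\<forall>c x. N (c *\<^sub>R x) = \<bar>c\<bar> * N x) \<and> (\<forall>x y. N (x + y) \<le> N x + N y)"

definition norm_ball :: "('a \<Rightarrow> real) \<Rightarrow> 'a set" where
  "norm_ball N = {x. N x \<le> 1}"

definition linear_hyperplane :: "(real ^ 'n) set \<Rightarrow> bool" where
  "linear_hyperplane H \<longleftrightarrow> (\<exists>a. a \<noteq> 0 \<and> H = {z. a \<bullet> z = 0})"

text \<open>
  Hyperplanes always pass through the origin; \<open>supports_at H C x\<close> is about the translate \<open>x + H\<close>.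
  Replacing the normal \<open>a\<close> by \<open>- a\<close> gives the other half-space, so a single inequality suffices.
\<close>

definition supports_at :: "(real ^ 'n) set \<Rightarrow> (real ^ 'n) set \<Rightarrow> real ^ 'n \<Rightarrow> bool" where
  "supports_at H C x \<longleftrightarrow>
     x \<in> frontier C \<and>
     (\<exists>a. a \<noteq> 0 \<and> H = {z. a \<bullet> z = 0} \<and> C \<subseteq> {y. a \<bullet> (y - x) \<le> 0})"

definition supporting_hyperplane :: "(real ^ 'n) set \<Rightarrow> real ^ 'n \<Rightarrow> (real ^ 'n) set" where
  "supporting_hyperplane C x = (THE H. supports_at H C x)"

definition smooth_norm :: "(real ^ 'n \<Rightarrow> real) \<Rightarrow> bool" where
  "smooth_norm N \<longleftrightarrow> (\<forall>x \<in> frontier (norm_ball N). \<exists>!H. supports_at H (norm_ball N) x)"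

definition strictly_convex_norm :: "(real ^ 'n \<Rightarrow> real) \<Rightarrow> bool" where
  "strictly_convex_norm N \<longleftrightarrow>
     \<not> (\<exists>a b. a \<noteq> b \<and> closed_segment a b \<subseteq> frontier (norm_ball N))"

definition birkhoff_orth :: "('a::real_vector \<Rightarrow> real) \<Rightarrow> 'a \<Rightarrow> 'a \<Rightarrow> bool" where
  "birkhoff_orth N x y \<longleftrightarrow> (\<forall>t::real. N (x + t *\<^sub>R y) \<ge> N x)"

definition birkhoff_orth_hyperplane :: "(real ^ 'n \<Rightarrow> real) \<Rightarrow> real ^ 'n \<Rightarrow> (real ^ 'n) set \<Rightarrow> bool" where
  "birkhoff_orth_hyperplane N x H \<longleftrightarrow> linear_hyperplane H \<and> (\<forall>z \<in> H. birkhoff_orth N x z)"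

definition right_orth_hyperplane :: "(real ^ 'n \<Rightarrow> real) \<Rightarrow> real ^ 'n \<Rightarrow> (real ^ 'n) set" where
  "right_orth_hyperplane N x = (THE H. birkhoff_orth_hyperplane N x H)"

definition legendre :: "(real ^ 'n \<Rightarrow> real) \<Rightarrow> real ^ 'n \<Rightarrow> (real ^ 'n \<Rightarrow> real)" where
  "legendre N x =
     (if x = 0 then (\<lambda>_. 0)
      else (THE \<phi>. linear \<phi> \<and> {z. \<phi> z = 0} = right_orth_hyperplane N x \<and> \<phi> x = (N x)\<^sup>2))"

definition norm_gradient :: "(real ^ 'n \<Rightarrow> real) \<Rightarrow> (real ^ 'n \<Rightarrow> real) \<Rightarrow> real ^ 'n \<Rightarrow> real ^ 'n" where
  "norm_gradient N f x =
     (if \<forall>y. f x \<le> f y then 0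
      else (THE v. v \<noteq> 0 \<and>
              birkhoff_orth_hyperplane N v (supporting_hyperplane {y. f y \<le> f x} x) \<and>
              frechet_derivative f (at x) v = (N v)\<^sup>2))"

end

theory Submission
  imports Defs
begin

text \<open>
  The functional \<open>\<L>(v)\<close> is characterised by \<open>\<phi>(v) = N(v)\<^sup>2\<close> together with
  \<open>\<phi> \<le> N(v) N\<close>: smoothness makes it exist and be unique, strict convexity makes \<open>\<L>\<close> injective, and
  maximising \<open>\<phi>\<close> over the compact unit ball makes \<open>\<L>\<close> surjective. If \<open>x\<close> does not minimise \<open>f\<close>,
  the only hyperplane supporting the sub-level set at \<open>x\<close> is the kernel of \<open>df\<^sub>x\<close>, so the norm
  gradient is the preimage of \<open>df\<^sub>x\<close> under \<open>\<L>\<close>. Both claims then say that \<open>df\<^sub>x\<close> is the unique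
  subgradient of \<open>f\<close> at \<open>x\<close>.
\<close>

section \<open>Linear functionals and their kernels\<close>

lemma linear_functional_eq_if_kernel_subset:
  fixes \<phi> \<psi> :: "'a::real_vector \<Rightarrow> real"
  assumes "linear \<phi>" and "linear \<psi>" and ker: "{z. \<phi> z = 0} \<subseteq> {z. \<psi> z = 0}"
    and "\<phi> x \<noteq> 0" and "\<phi> x = \<psi> x"
  shows "\<phi> = \<psi>"
proof
  fix z
  \<comment> \<open>Subtracting this multiple of \<open>x\<close> projects \<open>z\<close> onto the
    kernel of \<open>\<phi>\<close> along \<open>x\<close>.\<close>
  have "\<phi> (z - (\<phi> z / \<phi> x) *\<^sub>R x) = 0"
    using assms by (simp add: linear_diff linear_scale)
  then have "\<psi> (z - (\<phi> z / \<phi> x) *\<^sub>R x) = 0"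
    using ker by blast
  then show "\<phi> z = \<psi> z"
    using assms by (simp add: linear_diff linear_scale)
qed

lemma linear_functional_inner:
  fixes \<phi> :: "'a::euclidean_space \<Rightarrow> real"
  assumes "linear \<phi>"
  obtains a where "\<phi> = (\<lambda>z. a \<bullet> z)"
proof
  show "\<phi> = (\<lambda>z. adjoint \<phi> 1 \<bullet> z)"
    using adjoint_works[OF assms, of _ 1] by (auto simp: inner_commute)
qed

lemma linear_hyperplane_kernel:
  fixes \<phi> :: "real ^ 'n \<Rightarrow> real"
  assumes "linear \<phi>" and "\<phi> w \<noteq> 0"
  shows "linear_hyperplane {z. \<phi> z = 0}"
proof -
  obtain a where a: "\<phi> = (\<lambda>z. a \<bullet> z)"
    using linear_functional_inner[OF assms(1)] .
  then have "a \<noteq> 0"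
    using assms(2) by auto
  then show ?thesis
    unfolding linear_hyperplane_def a by blast
qed

section \<open>Continuity of the norm and compactness of its unit ball\<close>

context
  fixes N :: "real ^ 'n \<Rightarrow> real"
  assumes N: "is_norm N"
begin

lemma norm_nonneg: "0 \<le> N x"
  and norm_eq_0: "N x = 0 \<longleftrightarrow> x = 0"
  and norm_scale: "N (c *\<^sub>R x) = \<bar>c\<bar> * N x"
  and norm_triangle: "N (x + y) \<le> N x + N y"
  using N unfolding is_norm_def by blast+

lemma norm_pos: "x \<noteq> 0 \<Longrightarrow> 0 < N x"
  using norm_nonneg[of x] norm_eq_0[of x] by linarith

lemma norm_convex: "convex_on UNIV N"
proof (rule convex_onI)
  fix t :: real and x y
  assume "0 < t" "t < 1"
  then show "N ((1 - t) *\<^sub>R x + t *\<^sub>R y) \<le> (1 - t) * N x + t * N y"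
    using norm_triangle[of "(1 - t) *\<^sub>R x" "t *\<^sub>R y"] by (simp add: norm_scale)
qed simp

lemma norm_continuous: "continuous_on UNIV N"
  using convex_on_continuous[OF open_UNIV norm_convex] .

text \<open>The minimum of \<open>N\<close> on the Euclidean unit sphere is attained, hence
  positive, and homogeneity extends the bound. It makes the unit ball of \<open>N\<close>
  bounded.\<close>

lemma norm_lower_bound: "\<exists>m>0. \<forall>x. m * norm x \<le> N x"
proof -
  let ?S = "sphere (0::real^'n) 1"
  have "\<exists>u\<in>?S. \<forall>y\<in>?S. N u \<le> N y"
  proof (rule continuous_attains_inf)
    show "continuous_on ?S N"
      using norm_continuous continuous_on_subset by blast
  qed auto
  then obtain u where u: "u \<in> ?S" "\<And>y. y \<in> ?S \<Longrightarrow> N u \<le> N y"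
    by blast
  have "N u * norm x \<le> N x" for x
  proof (cases "x = 0")
    case False
    then have "N u \<le> N ((1 / norm x) *\<^sub>R x)"
      by (intro u(2)) simp
    with False show ?thesis
      by (simp add: norm_scale field_simps)
  qed (simp add: norm_nonneg)
  moreover have "0 < N u"
    using u(1) by (intro norm_pos) auto
  ultimately show ?thesis
    by blast
qed

lemma norm_ball_compact: "compact (norm_ball N)"
proof -
  obtain m where m: "0 < m" "\<And>x. m * norm x \<le> N x"
    using norm_lower_bound by blast
  have "norm x \<le> 1 / m" if "x \<in> norm_ball N" for x
    using m(1) m(2)[of x] that by (simp add: norm_ball_def field_simps)
  then have "bounded (norm_ball N)"
    using boundedI by blast
  moreover have "closed (norm_ball N)"
    unfolding norm_ball_def
    by (intro closed_Collect_le norm_continuous continuous_on_const)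
  ultimately show ?thesis
    by (simp add: compact_eq_bounded_closed)
qed

section \<open>Boundary points of the ball and Birkhoff orthogonality\<close>

lemma frontier_norm_ballI:
  assumes "N x = 1"
  shows "x \<in> frontier (norm_ball N)"
proof -
  have "x \<notin> interior (norm_ball N)"
  proof
    assume "x \<in> interior (norm_ball N)"
    then obtain e where e: "0 < e" "ball x e \<subseteq> norm_ball N"
      by (auto simp: mem_interior)
    have "x \<noteq> 0"
      using assms norm_eq_0[of x] by auto
    \<comment> \<open>A radial step of Euclidean length \<open>e / 2\<close> stays in
      \<open>ball x e\<close>, yet multiplies \<open>N\<close> by \<open>1 + d > 1\<close>.\<close>
    define d where "d = e / (2 * norm x)"
    have d: "0 < d"
      using e(1) \<open>x \<noteq> 0\<close> by (simp add: d_def)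
    have "dist x ((1 + d) *\<^sub>R x) = d * norm x"
      using d by (simp add: dist_norm algebra_simps)
    also have "\<dots> < e"
      using e(1) \<open>x \<noteq> 0\<close> by (simp add: d_def)
    finally have "N ((1 + d) *\<^sub>R x) \<le> 1"
      using e(2) by (auto simp: norm_ball_def)
    then show False
      using d assms by (simp add: norm_scale)
  qed
  moreover have "x \<in> closure (norm_ball N)"
    using assms closure_subset by (fastforce simp: norm_ball_def)
  ultimately show ?thesis
    by (simp add: frontier_def)
qed

text \<open>Both sides say that \<open>N\<close> is at least \<open>N x\<close> on the affine
  hyperplane \<open>x + H\<close>, up to scaling by \<open>N x\<close>. This is how smoothness, a
  statement about the ball, reaches Birkhoff orthogonality.\<close>

lemma birkhoff_orth_hyperplane_iff_supports:
  assumes "x \<noteq> 0"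
  shows "birkhoff_orth_hyperplane N x H \<longleftrightarrow> supports_at H (norm_ball N) ((1 / N x) *\<^sub>R x)"
    (is "_ \<longleftrightarrow> supports_at H _ ?u")
proof
  have Nx: "0 < N x"
    using assms by (rule norm_pos)
  then have Nu: "N ?u = 1"
    by (simp add: norm_scale)
  {
    assume B: "birkhoff_orth_hyperplane N x H"
    then obtain b where b: "b \<noteq> 0" "H = {z. b \<bullet> z = 0}"
      unfolding birkhoff_orth_hyperplane_def linear_hyperplane_def by blast
    have orth: "N x \<le> N (x + z)" if "z \<in> H" for z
      using B that unfolding birkhoff_orth_hyperplane_def birkhoff_orth_def
      by (metis scaleR_one)
    have "b \<bullet> x \<noteq> 0"
    proof
      assume "b \<bullet> x = 0"
      then have "- x \<in> H"
        by (simp add: b)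
      from orth[OF this] Nx norm_eq_0[of 0] show False
        by simp
    qed
    \<comment> \<open>Orient the normal so that \<open>x\<close> lies on its positive side.\<close>
    define a where "a = (if 0 < b \<bullet> x then b else - b)"
    have a: "a \<noteq> 0" "H = {z. a \<bullet> z = 0}" "0 < a \<bullet> x"
      using b \<open>b \<bullet> x \<noteq> 0\<close> by (auto simp: a_def)
    have "a \<bullet> y \<le> a \<bullet> ?u" if "N y \<le> 1" for y
    proof (cases "0 < a \<bullet> y")
      case True
      \<comment> \<open>The factor that moves \<open>y\<close> into \<open>x + H\<close>.\<close>
      define s where "s = (a \<bullet> x) / (a \<bullet> y)"
      have s: "0 < s"
        using True a(3) by (simp add: s_def)
      have "s *\<^sub>R y - x \<in> H"
        using True by (simp add: a(2) s_def inner_diff_right)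
      from orth[OF this] have "N x \<le> s * N y"
        using s by (simp add: norm_scale)
      also have "\<dots> \<le> s"
        using s that by (simp add: mult_left_le)
      finally show ?thesis
        using True Nx by (simp add: s_def field_simps)
    next
      case False
      moreover have "0 < a \<bullet> ?u"
        using a(3) Nx by simp
      ultimately show ?thesis
        by linarith
    qed
    then show "supports_at H (norm_ball N) ?u"
      unfolding supports_at_def
      using a frontier_norm_ballI[OF Nu] by (auto simp: norm_ball_def inner_diff_right)
  }
  {
    assume "supports_at H (norm_ball N) ?u"
    then obtain a where a: "a \<noteq> 0" "H = {z. a \<bullet> z = 0}"
      and "norm_ball N \<subseteq> {y. a \<bullet> (y - ?u) \<le> 0}"
      unfolding supports_at_def by blast
    then have le: "a \<bullet> y \<le> a \<bullet> ?u" if "N y \<le> 1" for y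
      using that by (fastforce simp: norm_ball_def inner_diff_right)
    have bound: "N x * (a \<bullet> y) \<le> N y * (a \<bullet> x)" if "y \<noteq> 0" for y
      using le[of "(1 / N y) *\<^sub>R y"] norm_pos[OF that] Nx
      by (simp add: norm_scale field_simps)
    \<comment> \<open>Testing the homogeneous bound at the normal \<open>a\<close> itself yields
      \<open>0 < a \<bullet> x\<close>.\<close>
    have "0 < N x * (a \<bullet> a)"
      using a(1) Nx by simp
    also have "\<dots> \<le> N a * (a \<bullet> x)"
      using bound[OF a(1)] .
    finally have pos: "0 < a \<bullet> x"
      using norm_pos[OF a(1)] by (simp add: zero_less_mult_iff)
    have "N x \<le> N (x + t *\<^sub>R z)" if "z \<in> H" for z t
    proof -
      have eq: "a \<bullet> (x + t *\<^sub>R z) = a \<bullet> x"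
        using that by (simp add: a(2) inner_add_right)
      then have "x + t *\<^sub>R z \<noteq> 0"
        using pos by auto
      from bound[OF this] pos show ?thesis
        by (simp add: eq)
    qed
    then show "birkhoff_orth_hyperplane N x H"
      unfolding birkhoff_orth_hyperplane_def linear_hyperplane_def birkhoff_orth_def
      using a by blast
  }
qed

text \<open>The translate of the kernel through \<open>v\<close> is the level set
  \<open>\<phi> = (N v)\<^sup>2\<close>. Rescaling any \<open>z\<close> with
  \<open>\<phi> z > 0\<close> into it turns \<open>N \<ge> N v\<close> on that set into the dual
  norm bound, with equality at \<open>v\<close>.\<close>

lemma birkhoff_orth_kernel_iff:
  fixes \<phi> :: "real ^ 'n \<Rightarrow> real"
  assumes "linear \<phi>" and "v \<noteq> 0" and v: "\<phi> v = (N v)\<^sup>2"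
  shows "birkhoff_orth_hyperplane N v {z. \<phi> z = 0} \<longleftrightarrow> (\<forall>z. \<phi> z \<le> N v * N z)"
proof
  have Nv: "0 < N v"
    using \<open>v \<noteq> 0\<close> by (rule norm_pos)
  {
    assume B: "birkhoff_orth_hyperplane N v {z. \<phi> z = 0}"
    have orth: "N v \<le> N (v + z)" if "\<phi> z = 0" for z
      using B that unfolding birkhoff_orth_hyperplane_def birkhoff_orth_def
      by (metis mem_Collect_eq scaleR_one)
    show "\<forall>z. \<phi> z \<le> N v * N z"
    proof
      fix z
      show "\<phi> z \<le> N v * N z"
      proof (cases "0 < \<phi> z")
        case True
        have "\<phi> (((N v)\<^sup>2 / \<phi> z) *\<^sub>R z - v) = 0"
          using True assms by (simp add: linear_diff linear_scale)
        from orth[OF this] have "N v \<le> (N v)\<^sup>2 / \<phi> z * N z"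
          using True by (simp add: norm_scale)
        then show ?thesis
          using True Nv by (simp add: field_simps power2_eq_square)
      next
        case False
        then show ?thesis
          using norm_nonneg[of v] norm_nonneg[of z]
          by (meson mult_nonneg_nonneg not_less order_trans)
      qed
    qed
  }
  {
    assume le: "\<forall>z. \<phi> z \<le> N v * N z"
    have "N v \<le> N (v + t *\<^sub>R z)" if "\<phi> z = 0" for z t
    proof -
      have "N v * N v = \<phi> (v + t *\<^sub>R z)"
        using that assms by (simp add: linear_add linear_scale power2_eq_square)
      also have "\<dots> \<le> N v * N (v + t *\<^sub>R z)"
        using le by blast
      finally show ?thesis
        using Nv by simp
    qed
    then show "birkhoff_orth_hyperplane N v {z. \<phi> z = 0}"
      using linear_hyperplane_kernel[OF assms(1), of v] v Nv
      unfolding birkhoff_orth_hyperplane_def birkhoff_orth_def by simp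
  }
qed

section \<open>The Legendre transform and its bijectivity\<close>

lemma birkhoff_orth_hyperplane_unique:
  assumes "smooth_norm N" and "x \<noteq> 0"
  shows "\<exists>!H. birkhoff_orth_hyperplane N x H"
proof -
  have "N ((1 / N x) *\<^sub>R x) = 1"
    using norm_pos[OF assms(2)] by (simp add: norm_scale)
  then show ?thesis
    using assms frontier_norm_ballI
    by (simp add: birkhoff_orth_hyperplane_iff_supports smooth_norm_def)
qed

text \<open>Smoothness forces the right-orthogonal hyperplane to be the kernel of
  \<open>\<phi>\<close>, and the kernel together with the value at \<open>v\<close> fixes the
  functional. For \<open>v = 0\<close> the bound at \<open>z\<close> and \<open>- z\<close> gives
  \<open>\<phi> = 0\<close>, in agreement with the separate case of the definition.\<close>

lemma legendre_eqI:
  assumes smooth: "smooth_norm N" and lin: "linear \<phi>"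
    and v: "\<phi> v = (N v)\<^sup>2" and le: "\<And>z. \<phi> z \<le> N v * N z"
  shows "legendre N v = \<phi>"
proof (cases "v = 0")
  case True
  have le0: "\<phi> z \<le> 0" for z
    using le[of z] True norm_eq_0[of 0] by simp
  have "\<phi> z = 0" for z
    using le0[of z] le0[of "- z"] lin by (simp add: linear_neg)
  with True show ?thesis
    by (auto simp: legendre_def)
next
  case False
  have "birkhoff_orth_hyperplane N v {z. \<phi> z = 0}"
    using birkhoff_orth_kernel_iff[OF lin False v] le by blast
  then have R: "right_orth_hyperplane N v = {z. \<phi> z = 0}"
    unfolding right_orth_hyperplane_def
    using birkhoff_orth_hyperplane_unique[OF smooth False] by (simp add: the1_equality)
  have "0 < N v"
    using False by (rule norm_pos)
  then have "(THE \<psi>. linear \<psi> \<and> {z. \<psi> z = 0} = {z. \<phi> z = 0} \<and> \<psi> v = (N v)\<^sup>2) = \<phi>"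
    using lin v
    by (intro the_equality) (auto intro!: linear_functional_eq_if_kernel_subset[where x = v])
  with False R show ?thesis
    by (simp add: legendre_def)
qed

lemma legendre_properties:
  assumes smooth: "smooth_norm N"
  shows "linear (legendre N v)" and "legendre N v v = (N v)\<^sup>2"
    and "legendre N v z \<le> N v * N z"
proof -
  have "\<exists>\<phi>. linear \<phi> \<and> \<phi> v = (N v)\<^sup>2 \<and> (\<forall>z. \<phi> z \<le> N v * N z)"
  proof (cases "v = 0")
    case True
    then show ?thesis
      using norm_eq_0[of 0] by (intro exI[of _ "\<lambda>_. 0"]) (simp add: linear_zero)
  next
    case False
    obtain H where H: "birkhoff_orth_hyperplane N v H"
      using birkhoff_orth_hyperplane_unique[OF smooth False] by blast
    then obtain a where a: "a \<noteq> 0" "H = {z. a \<bullet> z = 0}"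
      unfolding birkhoff_orth_hyperplane_def linear_hyperplane_def by blast
    have Nv: "0 < N v"
      using False by (rule norm_pos)
    have av: "a \<bullet> v \<noteq> 0"
    proof
      assume "a \<bullet> v = 0"
      then have "N v \<le> N (v + (-1) *\<^sub>R v)"
        using H a(2) unfolding birkhoff_orth_hyperplane_def birkhoff_orth_def by blast
      then show False
        using Nv norm_eq_0[of 0] by simp
    qed
    \<comment> \<open>The normal functional of \<open>H\<close>, rescaled to take the value
      \<open>(N v)\<^sup>2\<close> at \<open>v\<close>.\<close>
    define \<phi> where "\<phi> = (\<lambda>z. ((N v)\<^sup>2 / (a \<bullet> v)) * (a \<bullet> z))"
    have lin: "linear \<phi>"
      unfolding \<phi>_def by (intro linearI) (simp_all add: inner_add_right distrib_left)
    have v: "\<phi> v = (N v)\<^sup>2"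
      using av by (simp add: \<phi>_def)
    have "{z. \<phi> z = 0} = H"
      using av Nv by (simp add: \<phi>_def a(2))
    then show ?thesis
      using birkhoff_orth_kernel_iff[OF lin False v] H lin v by blast
  qed
  then obtain \<phi> where \<phi>: "linear \<phi>" "\<phi> v = (N v)\<^sup>2" "\<And>z. \<phi> z \<le> N v * N z"
    by blast
  then have "legendre N v = \<phi>"
    using legendre_eqI[OF smooth] by blast
  with \<phi> show "linear (legendre N v)" "legendre N v v = (N v)\<^sup>2" "legendre N v z \<le> N v * N z"
    by auto
qed

text \<open>Puts the equation into the form of the conditions that define
  \<open>norm_gradient\<close>.\<close>

lemma legendre_eq_iff_birkhoff_orth:
  assumes smooth: "smooth_norm N" and lin: "linear \<phi>" and "v \<noteq> 0"
  shows "legendre N v = \<phi> \<longleftrightarrow> birkhoff_orth_hyperplane N v {z. \<phi> z = 0} \<and> \<phi> v = (N v)\<^sup>2"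
  using legendre_eqI[OF smooth lin] legendre_properties[OF smooth, of v]
    birkhoff_orth_kernel_iff[OF lin \<open>v \<noteq> 0\<close>] by blast

lemma legendre_surj:
  assumes smooth: "smooth_norm N" and lin: "linear \<phi>"
  obtains v where "legendre N v = \<phi>"
proof -
  have "continuous_on (norm_ball N) \<phi>"
    using lin by (simp add: linear_continuous_on linear_linear)
  moreover have 0: "0 \<in> norm_ball N"
    using norm_eq_0[of 0] by (simp add: norm_ball_def)
  ultimately obtain u where u: "u \<in> norm_ball N" "\<And>y. y \<in> norm_ball N \<Longrightarrow> \<phi> y \<le> \<phi> u"
    using continuous_attains_sup[OF norm_ball_compact, of \<phi>] by blast
  have pos: "0 \<le> \<phi> u"
    using u(2)[OF 0] linear_0[OF lin] by simp
  \<comment> \<open>The maximum \<open>\<phi> u\<close> over the unit ball is the dual norm of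
    \<open>\<phi>\<close>.\<close>
  have le: "\<phi> z \<le> \<phi> u * N z" for z
  proof (cases "z = 0")
    case True
    then show ?thesis
      using norm_eq_0[of 0] linear_0[OF lin] by simp
  next
    case False
    then have "0 < N z"
      by (rule norm_pos)
    then show ?thesis
      using u(2)[of "(1 / N z) *\<^sub>R z"] lin
      by (simp add: norm_ball_def norm_scale linear_scale field_simps)
  qed
  \<comment> \<open>Scaling the maximiser by the dual norm makes both \<open>N v = \<phi> u\<close>
    and \<open>\<phi> v = (N v)\<^sup>2\<close> hold; for \<open>\<phi> = 0\<close> it gives
    \<open>v = 0\<close>.\<close>
  define v where "v = \<phi> u *\<^sub>R u"
  have "\<phi> v = (\<phi> u)\<^sup>2"
    using lin by (simp add: v_def linear_scale power2_eq_square)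
  moreover have "N v = \<phi> u"
  proof (rule antisym)
    show "N v \<le> \<phi> u"
      using u(1) pos by (simp add: v_def norm_scale norm_ball_def mult_left_le)
    show "\<phi> u \<le> N v"
      using le[of u] pos by (simp add: v_def norm_scale)
  qed
  ultimately have "legendre N v = \<phi>"
    using le by (intro legendre_eqI[OF smooth lin]) auto
  then show thesis
    by (rule that)
qed

text \<open>Distinct \<open>u\<close> and \<open>v\<close> with the same image have the same norm.
  The common functional is then constantly \<open>N u\<close> on the segment between their
  normalisations, so the dual norm bound keeps this segment in the unit sphere, against strict
  convexity.\<close>

lemma legendre_inj:
  assumes smooth: "smooth_norm N" and strict: "strictly_convex_norm N"
    and eq: "legendre N u = legendre N v"
  shows "u = v"
proof (rule ccontr)
  assume "u \<noteq> v"
  let ?\<phi> = "legendre N u"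
  note L = legendre_properties[OF smooth]
  \<comment> \<open>At \<open>p\<close> the common functional equals \<open>(N p)\<^sup>2\<close>
    and is at most \<open>N q * N p\<close>.\<close>
  have aux: "N p \<le> N q" if "legendre N p = legendre N q" for p q
  proof (cases "p = 0")
    case True
    then show ?thesis
      using norm_eq_0[of 0] norm_nonneg[of q] by simp
  next
    case False
    have "N p * N p \<le> N q * N p"
      using L(2)[of p] L(3)[of q p] that by (simp add: power2_eq_square)
    then show ?thesis
      using norm_pos[OF False] by simp
  qed
  have Nuv: "N u = N v"
    using aux[of u v] aux[of v u] eq by simp
  have "N u \<noteq> 0"
    using Nuv norm_eq_0[of u] norm_eq_0[of v] \<open>u \<noteq> v\<close> by auto
  then have Nu: "0 < N u"
    using norm_nonneg[of u] by linarith
  let ?c = "1 / N u"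
  have "closed_segment (?c *\<^sub>R u) (?c *\<^sub>R v) \<subseteq> frontier (norm_ball N)"
  proof
    fix y
    assume "y \<in> closed_segment (?c *\<^sub>R u) (?c *\<^sub>R v)"
    then obtain t where t: "0 \<le> t" "t \<le> 1" "y = (1 - t) *\<^sub>R ?c *\<^sub>R u + t *\<^sub>R ?c *\<^sub>R v"
      by (auto simp: in_segment)
    have "?\<phi> v = N u * N u"
      using L(2)[of v] eq Nuv by (simp add: power2_eq_square)
    then have "?\<phi> y = (1 - t) * N u + t * N u"
      using L(1)[of u] L(2)[of u] Nu t(3)
      by (simp add: linear_add linear_scale power2_eq_square)
    then have "N u * 1 = ?\<phi> y"
      by (simp add: algebra_simps)
    also have "\<dots> \<le> N u * N y"
      by (rule L(3))
    finally have "1 \<le> N y"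
      using Nu by simp
    moreover have "N y \<le> (1 - t) + t"
      using norm_triangle[of "(1 - t) *\<^sub>R ?c *\<^sub>R u" "t *\<^sub>R ?c *\<^sub>R v"] t Nu Nuv
      by (simp add: norm_scale)
    ultimately show "y \<in> frontier (norm_ball N)"
      by (intro frontier_norm_ballI) simp
  qed
  moreover have "?c *\<^sub>R u \<noteq> ?c *\<^sub>R v"
    using \<open>u \<noteq> v\<close> Nu by simp
  ultimately show False
    using strict unfolding strictly_convex_norm_def by blast
qed

end

section \<open>Convex functions: tangent inequality, sub-level sets, subgradients\<close>

lemma has_derivative_along_line:
  fixes f :: "'a::real_normed_vector \<Rightarrow> real"
  assumes "(f has_derivative D) (at x)"
  shows "((\<lambda>t. f (x + t *\<^sub>R w)) has_real_derivative D w) (at 0)"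
proof -
  have "((\<lambda>t. x + t *\<^sub>R w) has_derivative (\<lambda>t. t *\<^sub>R w)) (at 0)"
    by (auto intro!: derivative_eq_intros)
  then have "((\<lambda>t. f (x + t *\<^sub>R w)) has_derivative (\<lambda>t. D (t *\<^sub>R w))) (at 0)"
    using has_derivative_compose[of "\<lambda>t. x + t *\<^sub>R w" "\<lambda>t. t *\<^sub>R w" 0 UNIV f D] assms by simp
  then show ?thesis
    using has_derivative_linear[OF assms]
    by (simp add: has_field_derivative_def linear_scale mult.commute[of _ "D w"])
qed

text \<open>Restriction to the line through \<open>x\<close> and \<open>y\<close> reduces this to
  the tangent inequality in one real variable.\<close>

lemma convex_on_above_derivative:
  fixes f :: "'a::real_normed_vector \<Rightarrow> real"
  assumes "convex_on UNIV f" and "(f has_derivative D) (at x)"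
  shows "D (y - x) \<le> f y - f x"
proof -
  let ?g = "\<lambda>t. f (x + t *\<^sub>R (y - x))"
  have "convex_on UNIV ?g"
  proof (rule convex_onI)
    fix t r s :: real
    assume t: "0 < t" "t < 1"
    have "x + ((1 - t) *\<^sub>R r + t *\<^sub>R s) *\<^sub>R (y - x)
        = (1 - t) *\<^sub>R (x + r *\<^sub>R (y - x)) + t *\<^sub>R (x + s *\<^sub>R (y - x))"
      by (simp add: algebra_simps)
    then show "?g ((1 - t) *\<^sub>R r + t *\<^sub>R s) \<le> (1 - t) * ?g r + t * ?g s"
      using convex_onD[OF assms(1), of t "x + r *\<^sub>R (y - x)" "x + s *\<^sub>R (y - x)"] t by simp
  qed simp
  then have "D (y - x) * (1 - 0) \<le> ?g 1 - ?g 0"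
    using convex_on_imp_above_tangent[of UNIV ?g 0 1 "D (y - x)"]
      has_derivative_along_line[OF assms(2), of "y - x"] by simp
  then show ?thesis
    by simp
qed

text \<open>A direction with \<open>D z < 0\<close> enters the sub-level set, so a supporting normal
  \<open>a\<close> is nonpositive on that open half-space, and by a limit on the kernel of
  \<open>D\<close>. The kernel being symmetric, \<open>a\<close> vanishes there and is a multiple of
  \<open>D\<close>. Conversely, the tangent inequality puts the sub-level set into the half-space of
  \<open>D\<close>. The vector \<open>w\<close> witnesses that \<open>D\<close> is nonzero.\<close>

lemma supports_sublevel_iff:
  fixes f :: "real ^ 'n \<Rightarrow> real"
  assumes conv: "convex_on UNIV f" and der: "(f has_derivative D) (at x)" and w: "D w < 0"
  shows "supports_at H {y. f y \<le> f x} x \<longleftrightarrow> H = {z. D z = 0}"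
proof
  have lin: "linear D"
    using has_derivative_linear[OF der] .
  have tangent: "D (y - x) \<le> f y - f x" for y
    using convex_on_above_derivative[OF conv der] .
  {
    assume "supports_at H {y. f y \<le> f x} x"
    then obtain a where a: "a \<noteq> 0" "H = {z. a \<bullet> z = 0}"
      and sub: "{y. f y \<le> f x} \<subseteq> {y. a \<bullet> (y - x) \<le> 0}"
      unfolding supports_at_def by blast
    have descent: "a \<bullet> z \<le> 0" if z: "D z < 0" for z
    proof -
      obtain d where d: "0 < d" "\<And>h. 0 < h \<Longrightarrow> h < d \<Longrightarrow> f (x + h *\<^sub>R z) < f x"
        using DERIV_neg_dec_right[OF has_derivative_along_line[OF der, of z] z] by auto
      have "f (x + (d / 2) *\<^sub>R z) \<le> f x"
        using d(1) d(2)[of "d / 2"] by simp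
      then have "a \<bullet> ((d / 2) *\<^sub>R z) \<le> 0"
        using sub by fastforce
      then show ?thesis
        using d(1) by (simp add: mult_le_0_iff)
    qed
    have ker_le: "a \<bullet> z \<le> 0" if "D z = 0" for z
    proof (rule field_le_epsilon)
      fix e :: real
      assume e: "0 < e"
      \<comment> \<open>A small push along \<open>w\<close> makes \<open>z\<close> a descent
        direction at a cost of at most \<open>e\<close>; the summand 1 keeps the denominator
        positive when \<open>a \<bullet> w = 0\<close>.\<close>
      define s where "s = e / (1 - a \<bullet> w)"
      have aw: "a \<bullet> w \<le> 0"
        using descent[OF w] .
      then have s: "0 < s" "- (s * (a \<bullet> w)) \<le> e"
        using e by (simp_all add: s_def field_simps)
      have "D (z + s *\<^sub>R w) < 0"
        using that lin w s(1) by (simp add: linear_add linear_scale mult_less_0_iff)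
      from descent[OF this] have "a \<bullet> z \<le> - (s * (a \<bullet> w))"
        by (simp add: inner_add_right)
      with s(2) show "a \<bullet> z \<le> 0 + e"
        by simp
    qed
    have ker: "a \<bullet> z = 0" if "D z = 0" for z
      using ker_le[OF that] ker_le[of "- z"] that lin by (simp add: linear_neg)
    have split: "a \<bullet> z = (D z / D w) * (a \<bullet> w)" for z
      using ker[of "z - (D z / D w) *\<^sub>R w"] w lin
      by (simp add: linear_diff linear_scale inner_diff_right)
    \<comment> \<open>Otherwise \<open>split\<close> at \<open>a\<close> would give
      \<open>a \<bullet> a = 0\<close>.\<close>
    have "a \<bullet> w \<noteq> 0"
      using split[of a] a(1) by auto
    then have "a \<bullet> z = 0 \<longleftrightarrow> D z = 0" for z
      using split[of z] w by simp
    then show "H = {z. D z = 0}"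
      by (simp add: a(2))
  }
  {
    assume H: "H = {z. D z = 0}"
    obtain a where a: "D = (\<lambda>z. a \<bullet> z)"
      using linear_functional_inner[OF lin] .
    have "x \<notin> interior {y. f y \<le> f x}"
    proof
      assume "x \<in> interior {y. f y \<le> f x}"
      then obtain e where e: "0 < e" "ball x e \<subseteq> {y. f y \<le> f x}"
        by (auto simp: mem_interior)
      have "w \<noteq> 0"
        using w linear_0[OF lin] by auto
      \<comment> \<open>A step of length \<open>e / 2\<close> against \<open>w\<close>: by the
        tangent inequality \<open>f\<close> exceeds \<open>f x\<close> there.\<close>
      define s where "s = e / (2 * norm w)"
      have s: "0 < s"
        using e(1) \<open>w \<noteq> 0\<close> by (simp add: s_def)
      have "x - s *\<^sub>R w \<in> ball x e"
        using e(1) s \<open>w \<noteq> 0\<close> by (simp add: dist_norm s_def)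
      then have "f (x - s *\<^sub>R w) \<le> f x"
        using e(2) by blast
      with tangent[of "x - s *\<^sub>R w"] have "- (s * D w) \<le> 0"
        using lin by (simp add: linear_neg linear_scale)
      then show False
        using s w by (simp add: zero_le_mult_iff)
    qed
    moreover have "x \<in> closure {y. f y \<le> f x}"
      using closure_subset by fastforce
    moreover have "a \<noteq> 0"
      using w by (auto simp: a)
    moreover have "{y. f y \<le> f x} \<subseteq> {y. a \<bullet> (y - x) \<le> 0}"
    proof
      fix y
      assume "y \<in> {y. f y \<le> f x}"
      then show "y \<in> {y. a \<bullet> (y - x) \<le> 0}"
        using tangent[of y] by (simp add: a)
    qed
    ultimately show "supports_at H {y. f y \<le> f x} x"
      unfolding supports_at_def frontier_def H a by blast
  }
qed

text \<open>The function \<open>f - \<phi>\<close> has a global minimum at \<open>x\<close>, so its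
  derivative \<open>D - \<phi>\<close> vanishes.\<close>

lemma subgradient_eq_derivative:
  fixes f :: "'a::euclidean_space \<Rightarrow> real"
  assumes der: "(f has_derivative D) (at x)" and lin: "linear \<phi>"
    and sub: "\<And>y. \<phi> (y - x) \<le> f y - f x"
  shows "\<phi> = D"
proof -
  have "((\<lambda>y. f y - \<phi> y) has_derivative (\<lambda>z. D z - \<phi> z)) (at x)"
    using der lin by (intro has_derivative_diff linear_imp_has_derivative)
  moreover have "f x - \<phi> x \<le> f y - \<phi> y" for y
    using sub[of y] lin by (simp add: linear_diff)
  ultimately have "(\<lambda>z. D z - \<phi> z) = (\<lambda>_. 0)"
    using differential_zero_maxmin[of x UNIV "\<lambda>y. f y - \<phi> y"] by auto
  then show ?thesis
    by (metis eq_iff_diff_eq_0 ext)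
qed

section \<open>The norm gradient and the subgradient inequality\<close>

lemma legendre_norm_gradient:
  fixes N :: "real ^ 'n \<Rightarrow> real"
  assumes N: "is_norm N" and smooth: "smooth_norm N" and strict: "strictly_convex_norm N"
    and conv: "convex_on UNIV f" and der: "(f has_derivative D) (at x)"
  shows "legendre N (norm_gradient N f x) = D"
proof (cases "\<forall>y. f x \<le> f y")
  case True
  \<comment> \<open>At a minimiser the zero functional is a subgradient.\<close>
  then have "(\<lambda>_. 0) = D"
    by (intro subgradient_eq_derivative[OF der]) (simp_all add: linear_zero)
  with True show ?thesis
    by (simp add: norm_gradient_def legendre_def)
next
  case False
  then obtain y where "f y < f x"
    by (auto simp: not_le)
  then have w: "D (y - x) < 0"
    using convex_on_above_derivative[OF conv der, of y] by linarith
  have lin: "linear D"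
    using has_derivative_linear[OF der] .
  have D: "frechet_derivative f (at x) = D"
    using frechet_derivative_at[OF der] by simp
  have ker: "supporting_hyperplane {y. f y \<le> f x} x = {z. D z = 0}"
    unfolding supporting_hyperplane_def by (simp add: supports_sublevel_iff[OF conv der w])
  obtain v where v: "legendre N v = D"
    using legendre_surj[OF N smooth lin] .
  have nz: "u \<noteq> 0" if "legendre N u = D" for u
    using that w by (auto simp: legendre_def)
  \<comment> \<open>The defining conditions amount to \<open>legendre N u = D\<close>, and
    injectivity leaves only \<open>v\<close>, so the definite description is well defined.\<close>
  have "(u \<noteq> 0 \<and> birkhoff_orth_hyperplane N u {z. D z = 0} \<and> D u = (N u)\<^sup>2) \<longleftrightarrow> u = v" for u
    using legendre_eq_iff_birkhoff_orth[OF N smooth lin, of u] nz v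
      legendre_inj[OF N smooth strict, of u v] by metis
  then have "norm_gradient N f x = v"
    unfolding norm_gradient_def D ker using False by (simp only: if_False the_eq_trivial)
  with v show ?thesis
    by simp
qed

theorem theorem4p1:
  fixes N :: "real ^ 'n \<Rightarrow> real" and f :: "real ^ 'n \<Rightarrow> real" and x :: "real ^ 'n"
  assumes "is_norm N" and "smooth_norm N" and "strictly_convex_norm N"
    and "convex_on UNIV f" and "f differentiable (at x)"
  shows "(\<forall>y. f y - f x \<ge> legendre N (norm_gradient N f x) (y - x)) \<and>
         (\<forall>v. (\<forall>y. f y - f x \<ge> legendre N v (y - x)) \<longrightarrow> v = norm_gradient N f x)"
proof -
  obtain D where der: "(f has_derivative D) (at x)"
    using assms(5) unfolding differentiable_def by blast
  have grad: "legendre N (norm_gradient N f x) = D"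
    using legendre_norm_gradient[OF assms(1-4) der] .
  have "v = norm_gradient N f x" if "\<forall>y. f y - f x \<ge> legendre N v (y - x)" for v
  proof (rule legendre_inj[OF assms(1-3)])
    have "legendre N v = D"
      using that by (intro subgradient_eq_derivative[OF der] legendre_properties(1) assms(1,2)) auto
    then show "legendre N v = legendre N (norm_gradient N f x)"
      by (simp add: grad)
  qed
  then show ?thesis
    using convex_on_above_derivative[OF assms(4) der] by (simp add: grad)
qed

end
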